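(* Let $x^*\in\mathbb{R}^{nN}$ be the unique optimizer of $$\text{(P)}\qquad \min_{x\in\mathbb{R}^{nN}} \sum_{i=1}^N f_i(x_i)\quad \text{s.t.}\quad \sum_{i=1}^N g_i^k(x_i)\le 0,\ k\in\{1,\dots,p\},\qquad \sum_{i=1}^N h_i^l(x_i)=0,\ l\in\{1,\dots,q\},$$ and let $\mathcal{F}_r^*\subseteq \mathbb{R}^{nN}\times\mathbb{R}^{Np}\times\mathbb{R}^{Nq}$ be the set of solutions $(x,y,z)$ of $$\text{(R)}\qquad \min_{x\in\mathbb{R}^{nN},\,y\in\mathbb{R}^{Np},\,z\in\mathbb{R}^{Nq}} \sum_{i=1}^N f_i(x_i)$$ subject to, for all $i\in\{1,\dots,N\}$, $$g_i^k(x_i)+\sum_{j\in\mathcal{N}_i}(y_i^k-y_j^k)\le 0,\ k\in\{1,\dots,p\},\qquad h_i^l(x_i)+\sum_{j\in\mathcal{N}_i}(z_i^l-z_j^l)=0,\ l\in\{1,\dots,q\}.$$ Then the projection of $\mathcal{F}_r^*$ onto the $x$ variables is exactly the optimizer of (P): $\Pi_x(\mathcal{F}_r^* )=\{x^*\}$, where $\Pi_x(\mathcal{F}_r^* )=\{x : \exists\, (y,z) \text{ with } (x,y,z)\in\mathcal{F}_r^*\}$.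
   Context: $\mathcal{G}$ is a connected undirected graph with vertex set $\{1,\dots,N\}$; $\mathcal{N}_i$ is the set of neighbors of node $i$. For each $i\in\{1,\dots,N\}$, $k\in\{1,\dots,p\}$, $l\in\{1,\dots,q\}$: $f_i:\mathbb{R}^n\to\mathbb{R}$ is strongly convex and continuously differentiable with locally Lipschitz derivatives; $g_i^k:\mathbb{R}^n\to\mathbb{R}$ is convex and continuously differentiable with locally Lipschitz derivatives; $h_i^l:\mathbb{R}^n\to\mathbb{R}$ is affine. Write $x=[x_1,\dots,x_N]$ with $x_i\in\mathbb{R}^n$, $y=[y_1,\dots,y_N]$ with $y_i=[y_i^1,\dots,y_i^p]\in\mathbb{R}^p$, $z=[z_1,\dots,z_N]$ with $z_i=[z_i^1,\dots,z_i^q]\in\mathbb{R}^q$. Put $g^k(x)=\sum_{i=1}^N g_i^k(x_i)$ and $h^l(x)=\sum_{i=1}^N h_i^l(x_i)$. The feasible set of (P), $\mathcal{F}=\{x\in\mathbb{R}^{nN}: g^k(x)\le 0\ \forall k,\ h^l(x)=0\ \forall l\}$, is nonempty, so that (P) has a unique optimizer. Standing assumption (LICQ): for all $x\in\mathbb{R}^{nN}$, the vectors $\{\nabla g^k(x)\}_{k:\,g^k(x)=0}\cup\{\nabla h^l(x)\}_{1\le l\le q}$ are linearly independent. *)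

theory Defs
  imports "HOL-Analysis.Analysis"
begin

text \<open>
  The vertices are the elements of a finite type \<open>'v\<close> (so \<open>N = CARD('v)\<close>), and the stacked vector
  \<open>x = [x_1, ..., x_N]\<close> is an element of \<open>real^'n^'v\<close>, whose inner product is the Euclidean one of
  dimension \<open>n * N\<close>.  The constraint indices are natural numbers in \<open>{1..p}\<close> and \<open>{1..q}\<close>, so that
  \<open>p = 0\<close> or \<open>q = 0\<close> (no constraint of that kind) is covered.
\<close>

definition connected_graph :: "('v \<times> 'v) set \<Rightarrow> bool" where
  "connected_graph E \<longleftrightarrow> sym E \<and> (\<forall>i j. (i, j) \<in> E\<^sup>*)"

definition neighbors :: "('v \<times> 'v) set \<Rightarrow> 'v \<Rightarrow> 'v set" where
  "neighbors E i = {j. (i, j) \<in> E}"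

definition strongly_convex :: "('a::real_inner \<Rightarrow> real) \<Rightarrow> bool" where
  "strongly_convex f \<longleftrightarrow> (\<exists>\<mu>>0. \<forall>x y. \<forall>t\<in>{0..1}.
     f ((1 - t) *\<^sub>R x + t *\<^sub>R y)
       \<le> (1 - t) * f x + t * f y - \<mu> / 2 * t * (1 - t) * (norm (x - y))\<^sup>2)"

definition affine_fun :: "('a::real_vector \<Rightarrow> real) \<Rightarrow> bool" where
  "affine_fun h \<longleftrightarrow> (\<exists>L c. linear L \<and> (\<forall>x. h x = L x + c))"

text \<open>The value is meaningful only where the function is differentiable.\<close>

definition gradient :: "('a::real_inner \<Rightarrow> real) \<Rightarrow> 'a \<Rightarrow> 'a" where
  "gradient f x = (THE D. GDERIV f x :> D)"

text \<open>
  The library's \<open>local_lipschitz\<close> is about families of functions with a parameter, which is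
  trivial here.
\<close>

definition C1_locally_lipschitz :: "('a::real_inner \<Rightarrow> real) \<Rightarrow> bool" where
  "C1_locally_lipschitz f \<longleftrightarrow>
     (\<forall>x. f differentiable (at x)) \<and> continuous_on UNIV (gradient f) \<and>
     local_lipschitz {0::real} UNIV (\<lambda>_. gradient f)"

text \<open>Linear independence of a family: repeated vectors make it dependent.\<close>

definition independent_family :: "'i set \<Rightarrow> ('i \<Rightarrow> 'a::real_vector) \<Rightarrow> bool" where
  "independent_family I v \<longleftrightarrow> inj_on v I \<and> independent (v ` I)"

definition objective :: "('v::finite \<Rightarrow> real^'n \<Rightarrow> real) \<Rightarrow> real^'n^'v \<Rightarrow> real" where
  "objective f x = (\<Sum>i\<in>UNIV. f i (x $ i))"

definition total :: "('v::finite \<Rightarrow> nat \<Rightarrow> real^'n \<Rightarrow> real) \<Rightarrow> nat \<Rightarrow> real^'n^'v \<Rightarrow> real" where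
  "total c k x = (\<Sum>i\<in>UNIV. c i k (x $ i))"

definition LICQ_at ::
  "nat \<Rightarrow> nat \<Rightarrow> ('v::finite \<Rightarrow> nat \<Rightarrow> real^'n \<Rightarrow> real) \<Rightarrow> ('v \<Rightarrow> nat \<Rightarrow> real^'n \<Rightarrow> real)
     \<Rightarrow> real^'n^'v \<Rightarrow> bool" where
  "LICQ_at p q g h x \<longleftrightarrow>
     independent_family ({k\<in>{1..p}. total g k x = 0} <+> {1..q})
       (case_sum (\<lambda>k. gradient (total g k) x) (\<lambda>l. gradient (total h l) x))"

definition feasible_P ::
  "nat \<Rightarrow> nat \<Rightarrow> ('v::finite \<Rightarrow> nat \<Rightarrow> real^'n \<Rightarrow> real) \<Rightarrow> ('v \<Rightarrow> nat \<Rightarrow> real^'n \<Rightarrow> real)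
     \<Rightarrow> (real^'n^'v) set" where
  "feasible_P p q g h =
     {x. (\<forall>k\<in>{1..p}. total g k x \<le> 0) \<and> (\<forall>l\<in>{1..q}. total h l x = 0)}"

definition optimizer_P ::
  "nat \<Rightarrow> nat \<Rightarrow> ('v::finite \<Rightarrow> real^'n \<Rightarrow> real) \<Rightarrow> ('v \<Rightarrow> nat \<Rightarrow> real^'n \<Rightarrow> real)
     \<Rightarrow> ('v \<Rightarrow> nat \<Rightarrow> real^'n \<Rightarrow> real) \<Rightarrow> real^'n^'v \<Rightarrow> bool" where
  "optimizer_P p q f g h x \<longleftrightarrow> is_arg_min (objective f) (\<lambda>x. x \<in> feasible_P p q g h) x"

text \<open>
  The space \<open>\<real>\<^sup>m\<close>, with \<open>m = 0\<close> allowed, is represented by the functions on \<open>{1..m}\<close>, i.e. by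
  \<open>extensional {1..m}\<close>.
\<close>

definition feasible_R ::
  "('v \<times> 'v) set \<Rightarrow> nat \<Rightarrow> nat \<Rightarrow> ('v::finite \<Rightarrow> nat \<Rightarrow> real^'n \<Rightarrow> real)
     \<Rightarrow> ('v \<Rightarrow> nat \<Rightarrow> real^'n \<Rightarrow> real)
     \<Rightarrow> ((real^'n^'v) \<times> ('v \<Rightarrow> nat \<Rightarrow> real) \<times> ('v \<Rightarrow> nat \<Rightarrow> real)) set" where
  "feasible_R E p q g h =
     {(x, y, z). (\<forall>i. y i \<in> extensional {1..p}) \<and> (\<forall>i. z i \<in> extensional {1..q}) \<and>
       (\<forall>i. (\<forall>k\<in>{1..p}. g i k (x $ i) + (\<Sum>j\<in>neighbors E i. y i k - y j k) \<le> 0) \<and>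
            (\<forall>l\<in>{1..q}. h i l (x $ i) + (\<Sum>j\<in>neighbors E i. z i l - z j l) = 0))}"

definition solutions_R ::
  "('v \<times> 'v) set \<Rightarrow> nat \<Rightarrow> nat \<Rightarrow> ('v::finite \<Rightarrow> real^'n \<Rightarrow> real)
     \<Rightarrow> ('v \<Rightarrow> nat \<Rightarrow> real^'n \<Rightarrow> real) \<Rightarrow> ('v \<Rightarrow> nat \<Rightarrow> real^'n \<Rightarrow> real)
     \<Rightarrow> ((real^'n^'v) \<times> ('v \<Rightarrow> nat \<Rightarrow> real) \<times> ('v \<Rightarrow> nat \<Rightarrow> real)) set" where
  "solutions_R E p q f g h =
     {w. is_arg_min (\<lambda>(x, y, z). objective f x) (\<lambda>w. w \<in> feasible_R E p q g h) w}"

end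

theory Submission
  imports Defs
begin

text \<open>
  Summing the constraints of (R) over the nodes cancels the terms in \<open>y\<close> and \<open>z\<close>, because the graph
  Laplacian of an undirected graph has zero column sums.  Conversely, the Laplacian of a connected
  graph is self-adjoint with the constants as kernel, so its range consists of all vectors of zero
  sum; given a feasible point of (P), one can therefore choose \<open>y\<close> and \<open>z\<close> so as to spread each
  constraint evenly over the nodes.  Hence the feasible points of (P) are the projections of those
  of (R), and strict convexity makes the minimizer unique.
\<close>

section \<open>The graph Laplacian: column sums, kernel and range\<close>

lemma laplacian_as_edge_sum:
  fixes E :: "('v::finite \<times> 'v) set" and t y :: "'v \<Rightarrow> real"
  shows "(\<Sum>i\<in>UNIV. t i * (\<Sum>j\<in>neighbors E i. y i - y j))
       = (\<Sum>(i, j)\<in>E. t i * (y i - y j))"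
proof -
  have "E = (SIGMA i:UNIV. neighbors E i)"
    by (auto simp: neighbors_def)
  then have "(\<Sum>(i, j)\<in>E. t i * (y i - y j))
      = (\<Sum>(i, j)\<in>(SIGMA i:UNIV. neighbors E i). t i * (y i - y j))"
    by simp
  then show ?thesis
    by (simp add: sum.Sigma sum_distrib_left)
qed

text \<open>Reversal of edges is a bijection of a symmetric relation onto itself. It cancels
  antisymmetric sums and symmetrises the quadratic form of the Laplacian.\<close>

lemma sum_edges_swap:
  assumes "sym E"
  shows "(\<Sum>(i, j)\<in>E. F i j) = (\<Sum>(i, j)\<in>E. F j i)"
  by (rule sum.reindex_bij_witness[where i = prod.swap and j = prod.swap])
     (use assms in \<open>auto dest: symD\<close>)

lemma sum_laplacian_eq_0:
  fixes y :: "'v::finite \<Rightarrow> real"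
  assumes "sym E"
  shows "(\<Sum>i\<in>UNIV. \<Sum>j\<in>neighbors E i. y i - y j) = 0"
proof -
  have "(\<Sum>(i, j)\<in>E. y i - y j) = (\<Sum>(i, j)\<in>E. y j - y i)"
    by (rule sum_edges_swap[OF assms])
  also have "\<dots> = - (\<Sum>(i, j)\<in>E. y i - y j)"
    by (simp add: sum_negf[symmetric] case_prod_unfold)
  finally show ?thesis
    using laplacian_as_edge_sum[where t = "\<lambda>_. 1" and E = E and y = y] by simp
qed

text \<open>By edge reversal, twice the quadratic form is the sum of
  \<open>(t i - t j)\<^sup>2\<close> over \<open>E\<close>. If it vanishes, \<open>t\<close> agrees
  across every edge, hence along every path.\<close>

lemma laplacian_form_0_imp_constant:
  fixes t :: "'v::finite \<Rightarrow> real"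
  assumes graph: "connected_graph E"
    and zero: "(\<Sum>i\<in>UNIV. t i * (\<Sum>j\<in>neighbors E i. t i - t j)) = 0"
  shows "t i = t j"
proof -
  have "sym E" and "(i, j) \<in> E\<^sup>*"
    using graph by (auto simp: connected_graph_def)
  have A: "(\<Sum>(i, j)\<in>E. t i * (t i - t j)) = 0"
    using zero by (simp add: laplacian_as_edge_sum)
  then have B: "(\<Sum>(i, j)\<in>E. t j * (t j - t i)) = 0"
    using sum_edges_swap[OF \<open>sym E\<close>, of "\<lambda>i j. t i * (t i - t j)"] by simp
  have "(\<Sum>(i, j)\<in>E. (t i - t j)\<^sup>2)
      = (\<Sum>(i, j)\<in>E. t i * (t i - t j)) + (\<Sum>(i, j)\<in>E. t j * (t j - t i))"
    by (simp add: sum.distrib[symmetric] case_prod_unfold power2_eq_square algebra_simps)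
  then have "(\<Sum>(i, j)\<in>E. (t i - t j)\<^sup>2) = 0"
    using A B by simp
  then have edge: "t i = t j" if "(i, j) \<in> E" for i j
    using that by (subst (asm) sum_nonneg_eq_0_iff) auto
  show ?thesis
    using \<open>(i, j) \<in> E\<^sup>*\<close> by (induction rule: rtrancl_induct) (auto dest: edge)
qed

text \<open>The component \<open>t\<close> of \<open>b\<close> orthogonal to the range is in
  particular orthogonal to \<open>L t\<close>, so the quadratic form vanishes at \<open>t\<close>
  and \<open>t\<close> is constant. Since \<open>b\<close> has zero sum, \<open>t\<close> is
  orthogonal to \<open>b\<close>, thus to itself.\<close>

lemma laplacian_surj:
  fixes b :: "'v::finite \<Rightarrow> real"
  assumes graph: "connected_graph E" and sum0: "(\<Sum>i\<in>UNIV. b i) = 0"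
  shows "\<exists>y. \<forall>i. (\<Sum>j\<in>neighbors E i. y i - y j) = b i"
proof -
  define L :: "real^'v \<Rightarrow> real^'v"
    where "L y = (\<chi> i. \<Sum>j\<in>neighbors E i. y $ i - y $ j)" for y
  have "linear L"
    by (rule linearI)
       (simp_all add: L_def vec_eq_iff sum.distrib[symmetric] sum_distrib_left algebra_simps)
  then have sub: "subspace (range L)"
    by (intro linear_subspace_image subspace_UNIV)
  obtain s t where s: "s \<in> span (range L)"
    and orth: "\<And>w. w \<in> span (range L) \<Longrightarrow> orthogonal t w" and b: "(\<chi> i. b i) = s + t"
    using orthogonal_subspace_decomp_exists[of "range L" "\<chi> i. b i"] by metis
  have "t \<bullet> L t = 0"
    using orth[of "L t"] by (simp add: span_base orthogonal_def)
  then have "(\<Sum>i\<in>UNIV. t $ i * (\<Sum>j\<in>neighbors E i. t $ i - t $ j)) = 0"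
    by (simp add: inner_vec_def L_def)
  then have "t $ i = t $ j" for i j
    by (rule laplacian_form_0_imp_constant[OF graph])
  then obtain c where c: "\<And>i. t $ i = c"
    by metis
  have "t \<bullet> (\<chi> i. b i) = 0"
    using sum0 by (simp add: inner_vec_def c sum_distrib_left[symmetric])
  moreover have "t \<bullet> s = 0"
    using orth[OF s] by (simp add: orthogonal_def)
  ultimately have "t \<bullet> t = 0"
    by (simp add: b inner_add_right)
  then have "(\<chi> i. b i) = s"
    using b by simp
  moreover obtain y where "s = L y"
    using s sub by (metis imageE span_eq_iff)
  ultimately have "\<forall>i. (\<Sum>j\<in>neighbors E i. y $ i - y $ j) = b i"
    by (auto simp: L_def vec_eq_iff)
  then show ?thesis
    by (intro exI[of _ "\<lambda>i. y $ i"])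
qed

lemma laplacian_equidistribution:
  fixes a :: "'v::finite \<Rightarrow> nat \<Rightarrow> real"
  assumes graph: "connected_graph E"
  shows "\<exists>y. (\<forall>i. y i \<in> extensional {1..m}) \<and>
    (\<forall>i. \<forall>k\<in>{1..m}. a i k + (\<Sum>j\<in>neighbors E i. y i k - y j k)
        = (\<Sum>i\<in>UNIV. a i k) / CARD('v))"
proof -
  \<comment> \<open>For each \<open>k\<close>, the deviations of the node values from their mean
    have zero sum.\<close>
  have "\<exists>y. \<forall>i. (\<Sum>j\<in>neighbors E i. y i - y j) = (\<Sum>i\<in>UNIV. a i k) / CARD('v) - a i k" for k
    by (rule laplacian_surj[OF graph]) (simp add: sum_subtractf)
  then obtain Y where
    Y: "\<And>k i. (\<Sum>j\<in>neighbors E i. Y k i - Y k j) = (\<Sum>i\<in>UNIV. a i k) / CARD('v) - a i k"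
    by metis
  show ?thesis
    \<comment> \<open>Restriction gives the value \<open>undefined\<close> outside
      \<open>{1..m}\<close>, as \<open>extensional\<close> demands.\<close>
    by (rule exI[of _ "\<lambda>i. restrict (\<lambda>k. Y k i) {1..m}"]) (use Y in auto)
qed

section \<open>The feasible set of (P) as a projection of that of (R)\<close>

lemma feasible_P_iff_feasible_R:
  fixes x :: "real^'n^'v::finite"
  assumes graph: "connected_graph E"
  shows "x \<in> feasible_P p q g h \<longleftrightarrow> (\<exists>y z. (x, y, z) \<in> feasible_R E p q g h)"
proof
  assume x: "x \<in> feasible_P p q g h"
  obtain y where y: "\<forall>i. y i \<in> extensional {1..p}"
    "\<forall>i. \<forall>k\<in>{1..p}. g i k (x $ i) + (\<Sum>j\<in>neighbors E i. y i k - y j k)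
        = total g k x / CARD('v)"
    using laplacian_equidistribution[OF graph, of p "\<lambda>i k. g i k (x $ i)"]
    unfolding total_def by blast
  obtain z where z: "\<forall>i. z i \<in> extensional {1..q}"
    "\<forall>i. \<forall>l\<in>{1..q}. h i l (x $ i) + (\<Sum>j\<in>neighbors E i. z i l - z j l)
        = total h l x / CARD('v)"
    using laplacian_equidistribution[OF graph, of q "\<lambda>i l. h i l (x $ i)"]
    unfolding total_def by blast
  \<comment> \<open>Each node carries the mean, which inherits the sign or the vanishing of the
    total.\<close>
  have "(x, y, z) \<in> feasible_R E p q g h"
    using x y z by (auto simp: feasible_R_def feasible_P_def divide_nonpos_pos)
  then show "\<exists>y z. (x, y, z) \<in> feasible_R E p q g h"
    by blast
next
  assume "\<exists>y z. (x, y, z) \<in> feasible_R E p q g h"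
  then obtain y z where "(x, y, z) \<in> feasible_R E p q g h"
    by blast
  then have
    y: "\<And>i k. k \<in> {1..p} \<Longrightarrow> g i k (x $ i) + (\<Sum>j\<in>neighbors E i. y i k - y j k) \<le> 0" and
    z: "\<And>i l. l \<in> {1..q} \<Longrightarrow> h i l (x $ i) + (\<Sum>j\<in>neighbors E i. z i l - z j l) = 0"
    unfolding feasible_R_def by blast+
  have "sym E"
    using graph by (simp add: connected_graph_def)
  \<comment> \<open>Laplacian terms sum to zero over the nodes, so those of any \<open>w\<close> may
    be inserted; below, \<open>w\<close> is \<open>y\<close> for \<open>g\<close> and
    \<open>z\<close> for \<open>h\<close>.\<close>
  have total: "total c k x
      = (\<Sum>i\<in>UNIV. c i k (x $ i) + (\<Sum>j\<in>neighbors E i. w i k - w j k))" for c k w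
    using sum_laplacian_eq_0[OF \<open>sym E\<close>, of "\<lambda>i. w i k"] by (simp add: total_def sum.distrib)
  show "x \<in> feasible_P p q g h"
    using y z
    by (auto simp: feasible_P_def total[of g _ y] total[of h _ z] intro!: sum_nonpos sum.neutral)
qed

section \<open>Convexity and uniqueness of the optimizer\<close>

lemma convex_feasible_P:
  assumes g_convex: "\<And>i k. k \<in> {1..p} \<Longrightarrow> convex_on UNIV (g i k)"
    and h_affine: "\<And>i l. l \<in> {1..q} \<Longrightarrow> affine_fun (h i l)"
  shows "convex (feasible_P p q g h)"
proof (rule convexI)
  fix x y and u v :: real
  assume x: "x \<in> feasible_P p q g h" and y: "y \<in> feasible_P p q g h"
    and uv: "0 \<le> u" "0 \<le> v" "u + v = 1"
  have "total g k (u *\<^sub>R x + v *\<^sub>R y) \<le> 0" if k: "k \<in> {1..p}" for k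
  proof -
    have "total g k (u *\<^sub>R x + v *\<^sub>R y) \<le> (\<Sum>i\<in>UNIV. u * g i k (x $ i) + v * g i k (y $ i))"
      unfolding total_def
      using g_convex[OF k] uv by (intro sum_mono) (auto simp: convex_on_def)
    also have "\<dots> = u * total g k x + v * total g k y"
      by (simp add: total_def sum.distrib sum_distrib_left)
    also have "\<dots> \<le> 0"
      using x y k uv by (intro add_nonpos_nonpos mult_nonneg_nonpos) (auto simp: feasible_P_def)
    finally show ?thesis .
  qed
  moreover have "total h l (u *\<^sub>R x + v *\<^sub>R y) = 0" if l: "l \<in> {1..q}" for l
  proof -
    have "h i l (u *\<^sub>R a + v *\<^sub>R b) = u * h i l a + v * h i l b" for i a b
    proof -
      obtain L c where L: "linear L" "\<And>x. h i l x = L x + c"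
        using h_affine[OF l, of i] unfolding affine_fun_def by blast
      \<comment> \<open>The weights sum to 1, so affine functions preserve the combination although
        \<open>c\<close> may be nonzero.\<close>
      have "c = u * c + v * c"
        using uv by (simp add: distrib_right[symmetric])
      then show ?thesis
        by (simp add: L linear_add linear_scale distrib_left)
    qed
    then have "total h l (u *\<^sub>R x + v *\<^sub>R y) = u * total h l x + v * total h l y"
      by (simp add: total_def sum.distrib sum_distrib_left)
    then show ?thesis
      using x y l by (simp add: feasible_P_def)
  qed
  ultimately show "u *\<^sub>R x + v *\<^sub>R y \<in> feasible_P p q g h"
    by (simp add: feasible_P_def)
qed

lemma strongly_convex_midpoint_less:
  assumes "strongly_convex f" "x \<noteq> y"
  shows "f ((1/2) *\<^sub>R x + (1/2) *\<^sub>R y) < (f x + f y) / 2"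
proof -
  obtain \<mu> where "\<mu> > 0" and *: "\<forall>x y. \<forall>t\<in>{0..1}. f ((1 - t) *\<^sub>R x + t *\<^sub>R y)
       \<le> (1 - t) * f x + t * f y - \<mu> / 2 * t * (1 - t) * (norm (x - y))\<^sup>2"
    using assms(1) unfolding strongly_convex_def by blast
  have "\<mu> * (norm (x - y))\<^sup>2 > 0"
    using \<open>\<mu> > 0\<close> \<open>x \<noteq> y\<close> by simp
  \<comment> \<open>At \<open>t = 1/2\<close> the coefficient \<open>\<mu> / 2 * t * (1 - t)\<close>
    is \<open>\<mu> / 8\<close>.\<close>
  moreover have "f ((1/2) *\<^sub>R x + (1/2) *\<^sub>R y)
      \<le> f x / 2 + f y / 2 - \<mu> * (norm (x - y))\<^sup>2 / 8"
    using *[rule_format, of "1/2" x y] by simp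
  ultimately show ?thesis
    by (simp add: field_simps)
qed

lemma objective_midpoint_less:
  assumes sc: "\<And>i. strongly_convex (f i)" and "x \<noteq> y"
  shows "objective f ((1/2) *\<^sub>R x + (1/2) *\<^sub>R y) < (objective f x + objective f y) / 2"
proof -
  obtain i where i: "x $ i \<noteq> y $ i"
    using \<open>x \<noteq> y\<close> by (auto simp: vec_eq_iff)
  \<comment> \<open>Blocks that coincide give equality; strictness of the sum comes from the single
    block \<open>i\<close>.\<close>
  have le: "f j ((1/2) *\<^sub>R a + (1/2) *\<^sub>R b) \<le> (f j a + f j b) / 2" for j a b
    using strongly_convex_midpoint_less[OF sc[of j], of a b]
    by (cases "a = b") (auto simp: scaleR_left_distrib[symmetric])
  have "objective f ((1/2) *\<^sub>R x + (1/2) *\<^sub>R y) < (\<Sum>j\<in>UNIV. (f j (x $ j) + f j (y $ j)) / 2)"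
    unfolding objective_def
    using le strongly_convex_midpoint_less[OF sc[of i] i]
    by (intro sum_strict_mono_ex1) (auto intro!: exI[of _ i])
  then show ?thesis
    by (simp add: objective_def sum.distrib sum_divide_distrib[symmetric])
qed

text \<open>The midpoint of two distinct optimizers would be feasible by convexity and have a value
  strictly below their average.\<close>

lemma optimizer_P_unique:
  assumes sc: "\<And>i. strongly_convex (f i)" and conv: "convex (feasible_P p q g h)"
    and x: "optimizer_P p q f g h x" and y: "optimizer_P p q f g h y"
  shows "x = y"
proof (rule ccontr)
  assume "x \<noteq> y"
  let ?m = "(1/2) *\<^sub>R x + (1/2) *\<^sub>R y"
  have "?m \<in> feasible_P p q g h"
    using x y by (intro convexD[OF conv]) (auto simp: optimizer_P_def is_arg_min_def)
  then have "objective f x \<le> objective f ?m" "objective f y \<le> objective f ?m"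
    using x y by (auto simp: optimizer_P_def is_arg_min_linorder)
  with objective_midpoint_less[where f = f, OF sc \<open>x \<noteq> y\<close>] show False
    by simp
qed

section \<open>Transfer of optimality between (P) and (R)\<close>

lemma proj_solutions_R:
  assumes "connected_graph E"
  shows "(\<exists>y z. (x, y, z) \<in> solutions_R E p q f g h) \<longleftrightarrow> optimizer_P p q f g h x"
proof -
  \<comment> \<open>The objective reads only \<open>x\<close>, so \<open>y\<close> and
    \<open>z\<close> enter only through their existence.\<close>
  have "(\<exists>y z. (x, y, z) \<in> solutions_R E p q f g h) \<longleftrightarrow>
      (\<exists>y z. (x, y, z) \<in> feasible_R E p q g h) \<and>
      (\<forall>x'. (\<exists>y z. (x', y, z) \<in> feasible_R E p q g h) \<longrightarrow> objective f x \<le> objective f x')"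
    unfolding solutions_R_def is_arg_min_linorder by auto
  also have "\<dots> \<longleftrightarrow> optimizer_P p q f g h x"
    unfolding optimizer_P_def is_arg_min_linorder feasible_P_iff_feasible_R[OF assms] by blast
  finally show ?thesis .
qed

theorem mainTheorem1:
  fixes E :: "('v::finite \<times> 'v) set"
    and p q :: nat
    and f :: "'v \<Rightarrow> real^'n \<Rightarrow> real"
    and g h :: "'v \<Rightarrow> nat \<Rightarrow> real^'n \<Rightarrow> real"
    and xstar :: "real^'n^'v"
  assumes graph: "connected_graph E"
    and f_strongly_convex: "\<And>i. strongly_convex (f i)"
    and f_smooth: "\<And>i. C1_locally_lipschitz (f i)"
    and g_convex: "\<And>i k. k \<in> {1..p} \<Longrightarrow> convex_on UNIV (g i k)"
    and g_smooth: "\<And>i k. k \<in> {1..p} \<Longrightarrow> C1_locally_lipschitz (g i k)"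
    and h_affine: "\<And>i l. l \<in> {1..q} \<Longrightarrow> affine_fun (h i l)"
    and feasible: "feasible_P p q g h \<noteq> {}"
    and licq: "\<And>x. LICQ_at p q g h x"
    and optimizer: "optimizer_P p q f g h xstar"
  shows "{x. \<exists>y z. (x, y, z) \<in> solutions_R E p q f g h} = {xstar}"
proof -
  have "x = xstar" if "optimizer_P p q f g h x" for x
    using f_strongly_convex convex_feasible_P[OF g_convex h_affine] that optimizer
    by (rule optimizer_P_unique)
  then show ?thesis
    unfolding proj_solutions_R[OF graph] using optimizer by blast
qed

end
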